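(* Let $G$ be a finite simple graph with $\gamma(G)=k$, and let $G'$ be the graph obtained from $G$ by adding one new isolated vertex. Then $\gamma(G')=k$.
   Context: All graphs are finite, simple and undirected. A graph $G=(V,E)$ is a star-$k$-PCG if there exist a weight function $w:V\to\mathbb{R}^+$ and $k$ pairwise disjoint intervals $I_1,\dots,I_k$ such that for distinct $u,v\in V$, $uv\in E$ if and only if $w(u)+w(v)\in\bigcup_i I_i$. The star number $\gamma(G)$ is the least positive integer $k$ such that $G$ is a star-$k$-PCG. *)

theory Defs
  imports "HOL-Analysis.Analysis" "Graph_Theory.Digraph"
begin

text \<open>
  A finite simple undirected graph is an instance of the locale \<open>graph\<close> of \<open>Graph_Theory\<close>: a finite
  digraph without loops and parallel arcs whose adjacency relation is symmetric. Intervals may be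
  open, closed, half-open, degenerate or unbounded; they are required to be nonempty, so that
  disjointness makes them \<open>k\<close> distinct intervals.
\<close>

definition star_k_pcg :: "('a, 'b) pre_digraph \<Rightarrow> nat \<Rightarrow> bool" where
  "star_k_pcg G k \<longleftrightarrow>
     (\<exists>(w :: 'a \<Rightarrow> real) (I :: nat \<Rightarrow> real set).
        (\<forall>v\<in>verts G. 0 < w v) \<and>
        (\<forall>i<k. is_interval (I i) \<and> I i \<noteq> {}) \<and>
        disjoint_family_on I {..<k} \<and>
        (\<forall>u\<in>verts G. \<forall>v\<in>verts G. u \<noteq> v \<longrightarrow>
           (u \<rightarrow>\<^bsub>G\<^esub> v \<longleftrightarrow> w u + w v \<in> (\<Union>i<k. I i))))"

definition star_number :: "('a, 'b) pre_digraph \<Rightarrow> nat" where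
  "star_number G = (LEAST k. 0 < k \<and> star_k_pcg G k)"

end

theory Submission
  imports Defs
begin

text \<open>
  Truncating the finitely many intervals at a large bound \<open>M\<close> keeps them nonempty and does not affect
  the finitely many sums of weights; a new vertex of weight \<open>M + 1\<close> then has all its sums above \<open>M\<close>.
  So a graph and its extension by an isolated vertex are star-\<open>k\<close>-PCGs for the same \<open>k\<close>.
\<close>

text \<open>Adjacency is membership in \<open>arcs_ends\<close>, so rewriting with this equation
  reduces adjacency in the extended graph to adjacency in \<open>G\<close>.\<close>

lemma arcs_ends_add_vert:
  "arcs_ends (pre_digraph.add_vert G v) = arcs_ends G"
  by (simp add: pre_digraph.add_vert_def arcs_ends_def arc_to_ends_def)

text \<open>The same weights and intervals serve for \<open>G\<close>: its vertices are among those
  of the extension, and adjacency is unchanged.\<close>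

lemma star_k_pcg_of_add_vert:
  assumes "star_k_pcg (pre_digraph.add_vert G v) k"
  shows "star_k_pcg G k"
proof -
  have sub: "x \<in> verts (pre_digraph.add_vert G v)" if "x \<in> verts G" for x
    using that by (simp add: pre_digraph.verts_add_vert)
  show ?thesis
    using assms unfolding star_k_pcg_def arcs_ends_add_vert
    by (elim ex_forward conjE) (intro conjI ballI; simp add: sub)
qed

lemma star_k_pcg_add_vert:
  assumes "fin_digraph G" and v: "v \<notin> verts G" and "star_k_pcg G k"
  shows "star_k_pcg (pre_digraph.add_vert G v) k"
proof -
  interpret fin_digraph G by fact
  obtain w :: "'a \<Rightarrow> real" and I :: "nat \<Rightarrow> real set" where
    w: "\<And>x. x \<in> verts G \<Longrightarrow> 0 < w x" and
    I: "\<And>i. i < k \<Longrightarrow> is_interval (I i)" "\<And>i. i < k \<Longrightarrow> I i \<noteq> {}" and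
    disj: "disjoint_family_on I {..<k}" and
    adj: "\<And>x y. x \<in> verts G \<Longrightarrow> y \<in> verts G \<Longrightarrow> x \<noteq> y \<Longrightarrow>
            x \<rightarrow>\<^bsub>G\<^esub> y \<longleftrightarrow> w x + w y \<in> (\<Union>i<k. I i)"
    using assms(3) unfolding star_k_pcg_def by (elim exE conjE) (rule that; simp)
  \<comment> \<open>One sample point per interval; a bound above all of them keeps every truncated
    interval nonempty.\<close>
  define p where "p i = (SOME x. x \<in> I i)" for i
  have p: "p i \<in> I i" if "i < k" for i
    using I(2)[OF that] by (simp add: p_def some_in_eq)
  \<comment> \<open>The element 0 makes \<open>S\<close> nonempty, so that \<open>Max\<close> is
    meaningful even without vertices or intervals, and gives 0 \<le> \<open>M\<close>, hence a
    positive weight \<open>M + 1\<close>.\<close>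
  define S where
    "S = insert 0 (p ` {..<k} \<union> (\<lambda>(x, y). w x + w y) ` (verts G \<times> verts G))"
  define M where "M = Max S"
  have "finite S" by (simp add: S_def)
  then have M: "s \<le> M" if "s \<in> S" for s
    using that by (simp add: M_def)
  have M0: "0 \<le> M" and Mp: "\<And>i. i < k \<Longrightarrow> p i \<le> M"
    and Mw: "\<And>x y. x \<in> verts G \<Longrightarrow> y \<in> verts G \<Longrightarrow> w x + w y \<le> M"
    by (rule M, force simp: S_def)+
  define w' where "w' = w(v := M + 1)"
  \<comment> \<open>The cut is closed at \<open>M\<close>, so a sample point or a sum equal to
    \<open>M\<close> survives.\<close>
  define J where "J i = I i \<inter> {..M}" for i
  have old: "w' x = w x" if "x \<in> verts G" for x
    using that v by (auto simp: w'_def)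
  \<comment> \<open>Endpoints of arcs are vertices of \<open>G\<close>, so \<open>v\<close> is
    isolated.\<close>
  have no_arc: "\<not> x \<rightarrow>\<^bsub>G\<^esub> v" "\<not> v \<rightarrow>\<^bsub>G\<^esub> x" for x
    using v adj_in_verts by blast+
  have new: "w x + (M + 1) \<notin> (\<Union>i<k. J i)" if "x \<in> verts G" for x
    using w[OF that] by (auto simp: J_def)
  have w'_pos: "0 < w' x" if "x \<in> verts (add_vert v)" for x
    using that M0 w by (auto simp: verts_add_vert w'_def)
  have J_int: "\<forall>i<k. is_interval (J i) \<and> J i \<noteq> {}"
    using I(1) p Mp by (auto simp: J_def is_interval_Int)
  have J_disj: "disjoint_family_on J {..<k}"
    using disj by (auto simp: J_def disjoint_family_on_def)
  have adj': "x \<rightarrow>\<^bsub>add_vert v\<^esub> y \<longleftrightarrow> w' x + w' y \<in> (\<Union>i<k. J i)"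
    if xy: "x \<in> verts (add_vert v)" "y \<in> verts (add_vert v)" "x \<noteq> y" for x y
  proof -
    \<comment> \<open>The case where both are \<open>v\<close> is excluded by
      \<open>x \<noteq> y\<close>.\<close>
    consider "x \<in> verts G" "y \<in> verts G" | "x = v" "y \<in> verts G" | "x \<in> verts G" "y = v"
      using xy by (auto simp: verts_add_vert)
    then show ?thesis
    proof cases
      case 1
      then have "w x + w y \<in> (\<Union>i<k. J i) \<longleftrightarrow> w x + w y \<in> (\<Union>i<k. I i)"
        using Mw by (auto simp: J_def)
      with 1 xy(3) show ?thesis by (simp add: arcs_ends_add_vert adj old)
    next
      case 2
      then show ?thesis
        using new[of y] no_arc xy(3) by (simp add: arcs_ends_add_vert old w'_def add.commute)
    next
      case 3
      then show ?thesis
        using new[of x] no_arc xy(3) by (simp add: arcs_ends_add_vert old w'_def)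
    qed
  qed
  show ?thesis
    unfolding star_k_pcg_def
    by (intro exI[of _ w'] exI[of _ J] conjI ballI impI w'_pos J_int J_disj adj')
qed

theorem theorem2:
  fixes G :: "('a, 'b) pre_digraph" and v :: 'a and k :: nat
  assumes "graph G"
    and "star_number G = k"
    and "v \<notin> verts G"
  shows "star_number (pre_digraph.add_vert G v) = k"
proof -
  interpret graph G by fact
  \<comment> \<open>With this for every \<open>j\<close>, both \<open>LEAST\<close> terms minimise
    over the same predicate.\<close>
  have "star_k_pcg (add_vert v) j \<longleftrightarrow> star_k_pcg G j" for j
    by (rule iffI[OF star_k_pcg_of_add_vert star_k_pcg_add_vert[OF fin_digraph_axioms assms(3)]])
  then show ?thesis
    using assms(2) by (simp add: star_number_def)
qed

end
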